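(* A discrete multiple set $\{a_n\}_{n\in\mathbb{N}}\subset\mathbb{R}^k$ is almost periodic if and only if for every sequence $(h_p)_{p=1}^\infty\subset\mathbb{R}^k$ there is a subsequence $(h_p')_{p=1}^\infty$ such that the sequence of discrete multiple sets $(\{a_n+h_p'\}_{n\in\mathbb{N}})_{p=1}^\infty$ has a limit with respect to $\mathrm{dist}$, i.e. there is a discrete multiple set $D'$ with $\mathrm{dist}(\{a_n+h_p'\}_{n\in\mathbb{N}},D')\to0$ as $p\to\infty$.
   Context: A discrete multiple set $\{a_n\}_{n\in\mathbb{N}}$ in $\mathbb{R}^k$ is the value set, counted with multiplicity, of a sequence $(a_n)_{n=1}^\infty\subset\mathbb{R}^k$ having no finite limit points (equivalently, every bounded set contains $a_n$ for only finitely many indices $n$). Two sequences differing by a permutation of indices define the same discrete multiple set. For discrete multiple sets put $\mathrm{dist}(\{a_n\}_{n\in\mathbb{N}},\{b_n\}_{n\in\mathbb{N}})=\inf_{\sigma}\sup_{n\in\mathbb{N}}|a_n-b_{\sigma(n)}|\in[0,\infty]$, the infimum over all bijections $\sigma:\mathbb{N}\to\mathbb{N}$, where $|\cdot|$ is the Euclidean norm. A vector $\tau\in\mathbb{R}^k$ is an $\varepsilon$-almost period of $\{a_n\}_{n\in\mathbb{N}}$ if $\mathrm{dist}(\{a_n\}_{n\in\mathbb{N}},\{a_n+\tau\}_{n\in\mathbb{N}})<\varepsilon$. A set $E\subset\mathbb{R}^k$ is relatively dense if there is $L<\infty$ such that every ball of radius $L$ in $\mathbb{R}^k$ meets $E$.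 A discrete multiple set is almost periodic if for each $\varepsilon>0$ the set of its $\varepsilon$-almost periods is relatively dense in $\mathbb{R}^k$. *)

theory Defs
  imports "HOL-Analysis.Analysis"
begin

text \<open>
  A discrete multiple set is represented by any sequence enumerating it (with multiplicity).
  Two sequences represent the same set iff they differ by a permutation of the indices; the
  notions below do not depend on the choice of the representative (see the lemmas named
  \<open>*_permute\<close>).
\<close>

definition discrete_multiple_set :: "(nat \<Rightarrow> real ^ 'k) \<Rightarrow> bool" where
  "discrete_multiple_set a \<longleftrightarrow> \<not> (\<exists>l r. strict_mono (r :: nat \<Rightarrow> nat) \<and> (a \<circ> r) \<longlonglongrightarrow> l)"

definition ms_dist :: "(nat \<Rightarrow> real ^ 'k) \<Rightarrow> (nat \<Rightarrow> real ^ 'k) \<Rightarrow> ennreal" where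
  "ms_dist a b = (INF \<sigma> \<in> {\<sigma> :: nat \<Rightarrow> nat. bij \<sigma>}. SUP n. ennreal (norm (a n - b (\<sigma> n))))"

definition ms_translate :: "(nat \<Rightarrow> real ^ 'k) \<Rightarrow> real ^ 'k \<Rightarrow> (nat \<Rightarrow> real ^ 'k)" where
  "ms_translate a h = (\<lambda>n. a n + h)"

definition almost_period :: "(nat \<Rightarrow> real ^ 'k) \<Rightarrow> real \<Rightarrow> real ^ 'k \<Rightarrow> bool" where
  "almost_period a \<epsilon> \<tau> \<longleftrightarrow> ms_dist a (ms_translate a \<tau>) < ennreal \<epsilon>"

text \<open>No condition \<open>L > 0\<close> is needed, since \<open>ball x L\<close> is empty for \<open>L \<le> 0\<close>.\<close>

definition relatively_dense :: "(real ^ 'k) set \<Rightarrow> bool" where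
  "relatively_dense E \<longleftrightarrow> (\<exists>L :: real. \<forall>x. ball x L \<inter> E \<noteq> {})"

definition almost_periodic :: "(nat \<Rightarrow> real ^ 'k) \<Rightarrow> bool" where
  "almost_periodic a \<longleftrightarrow> (\<forall>\<epsilon>>0. relatively_dense {\<tau>. almost_period a \<epsilon> \<tau>})"

lemma discrete_multiple_set_iff_bounded:
  fixes a :: "nat \<Rightarrow> real ^ 'k"
  shows "discrete_multiple_set a \<longleftrightarrow> (\<forall>B. bounded B \<longrightarrow> finite {n. a n \<in> B})"
proof (intro iffI allI impI)
  fix B :: "(real ^ 'k) set" assume a: "discrete_multiple_set a" and B: "bounded B"
  show "finite {n. a n \<in> B}"
  proof (rule ccontr)
    assume inf: "infinite {n. a n \<in> B}"
    define r where "r = enumerate {n. a n \<in> B}"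
    have r: "strict_mono r"
      unfolding r_def using inf by (rule strict_mono_enumerate)
    have "a (r n) \<in> B" for n
      using enumerate_in_set[OF inf, of n] by (simp add: r_def)
    then have "bounded (range (a \<circ> r))"
      using B by (auto intro: bounded_subset)
    then obtain l s where "strict_mono (s :: nat \<Rightarrow> nat)" "((a \<circ> r) \<circ> s) \<longlonglongrightarrow> l"
      using bounded_imp_convergent_subsequence by blast
    then have "strict_mono (r \<circ> s)" "(a \<circ> (r \<circ> s)) \<longlonglongrightarrow> l"
      using r by (auto simp: strict_mono_o comp_assoc)
    then show False
      using a unfolding discrete_multiple_set_def by blast
  qed
next
  assume fin: "\<forall>B. bounded B \<longrightarrow> finite {n. a n \<in> B}"
  show "discrete_multiple_set a"
    unfolding discrete_multiple_set_def
  proof (intro notI, elim exE conjE)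
    fix l and r :: "nat \<Rightarrow> nat"
    assume r: "strict_mono r" and l: "(a \<circ> r) \<longlonglongrightarrow> l"
    have "bounded (range (a \<circ> r))"
      using l convergent_imp_bounded by blast
    then have "finite {n. a n \<in> range (a \<circ> r)}"
      using fin by blast
    moreover have "range r \<subseteq> {n. a n \<in> range (a \<circ> r)}"
      by auto
    ultimately have "finite (range r)"
      by (rule rev_finite_subset)
    then show False
      using r finite_imageD infinite_UNIV_nat strict_mono_imp_inj_on by blast
  qed
qed

lemma discrete_multiple_set_permute:
  assumes "bij \<pi>"
  shows "discrete_multiple_set (a \<circ> \<pi>) \<longleftrightarrow> discrete_multiple_set a"
proof -
  have "finite {n. (a \<circ> \<pi>) n \<in> B} \<longleftrightarrow> finite {n. a n \<in> B}" for B
  proof -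
    have "{n. (a \<circ> \<pi>) n \<in> B} = \<pi> -` {n. a n \<in> B}"
      by auto
    then show ?thesis
      using assms by (metis bij_def finite_vimage_iff)
  qed
  then show ?thesis
    by (simp only: discrete_multiple_set_iff_bounded)
qed

lemma ms_dist_permute:
  assumes "bij \<pi>" "bij \<rho>"
  shows "ms_dist (a \<circ> \<pi>) (b \<circ> \<rho>) = ms_dist a b"
proof -
  have le: "ms_dist (a \<circ> \<pi>) (b \<circ> \<rho>) \<le> ms_dist a b"
    if bij: "bij \<pi>" "bij \<rho>" for a b :: "nat \<Rightarrow> real ^ 'k" and \<pi> \<rho>
    unfolding ms_dist_def
  proof (rule INF_mono)
    fix \<sigma> :: "nat \<Rightarrow> nat" assume "\<sigma> \<in> {\<sigma>. bij \<sigma>}"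
    then have "bij (inv \<rho> \<circ> \<sigma> \<circ> \<pi>)"
      using bij by (auto intro!: bij_comp bij_imp_bij_inv)
    moreover have "(SUP n. ennreal (norm ((a \<circ> \<pi>) n - (b \<circ> \<rho>) ((inv \<rho> \<circ> \<sigma> \<circ> \<pi>) n))))
        \<le> (SUP n. ennreal (norm (a n - b (\<sigma> n))))"
    proof (rule SUP_least)
      fix n
      have "\<rho> (inv \<rho> (\<sigma> (\<pi> n))) = \<sigma> (\<pi> n)"
        using bij by (simp add: bij_is_surj surj_f_inv_f)
      then show "ennreal (norm ((a \<circ> \<pi>) n - (b \<circ> \<rho>) ((inv \<rho> \<circ> \<sigma> \<circ> \<pi>) n)))
          \<le> (SUP n. ennreal (norm (a n - b (\<sigma> n))))"
        by (auto intro: SUP_upper2[where i = "\<pi> n"])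
    qed
    ultimately show "\<exists>\<sigma>'\<in>{\<sigma>. bij \<sigma>}. (SUP n. ennreal (norm ((a \<circ> \<pi>) n - (b \<circ> \<rho>) (\<sigma>' n))))
        \<le> (SUP n. ennreal (norm (a n - b (\<sigma> n))))"
      by blast
  qed
  have "ms_dist ((a \<circ> \<pi>) \<circ> inv \<pi>) ((b \<circ> \<rho>) \<circ> inv \<rho>) \<le> ms_dist (a \<circ> \<pi>) (b \<circ> \<rho>)"
    using assms by (intro le bij_imp_bij_inv)
  then have "ms_dist a b \<le> ms_dist (a \<circ> \<pi>) (b \<circ> \<rho>)"
    using assms by (simp add: comp_assoc bij_is_surj surj_iff[THEN iffD1])
  then show ?thesis
    using le[OF assms] by (intro antisym)
qed

lemma almost_periodic_permute:
  assumes "bij \<pi>"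
  shows "almost_periodic (a \<circ> \<pi>) \<longleftrightarrow> almost_periodic a"
proof -
  have "ms_translate (a \<circ> \<pi>) h = ms_translate a h \<circ> \<pi>" for h
    by (auto simp: ms_translate_def)
  then show ?thesis
    by (simp add: almost_periodic_def almost_period_def ms_dist_permute assms)
qed

end

theory Submission
  imports Defs "HOL-Library.Diagonal_Subsequence"
begin

text \<open>
  The theorem is Bochner's criterion, and it holds for the reason it holds for almost periodic
  functions: the translates of the multiple set live in a complete pseudometric space (infinite
  distances may occur) on which \<open>\<real>\<^sup>k\<close> acts by isometries. Three properties of \<open>ms_dist\<close> carry the argument: the triangle
  inequality, the invariance under a common translation, and the bound \<open>norm h\<close> for the
  distance moved under a translation by \<open>h\<close>.

  Suppose that the set is almost periodic. Every \<open>h\<close> is then an \<open>\<epsilon>\<close>-almost period plus a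
  remainder in a fixed ball, so up to \<open>\<epsilon>\<close> the translates are indexed by a bounded set; a
  convergent subsequence of the remainders gives translates that are uniformly close to each
  other, and a diagonal argument over \<open>\<epsilon> = 2\<^sup>-\<^sup>n\<close> gives a subsequence of translates whose
  consecutive distances are below \<open>2\<^sup>-\<^sup>p\<close> (\<open>fast_Cauchy_translates\<close>). Such a sequence
  converges (\<open>fast_Cauchy_ms_converges\<close>): composing the near-optimal matchings of consecutive
  sets renumbers all of them so that the sequences of points converge uniformly, and a uniform
  limit of discrete sequences is discrete.

  Conversely, if the \<open>\<epsilon>\<close>-almost periods leave gaps of arbitrary size, vectors \<open>h\<^sub>p\<close> can be chosen
  one after the other so that no difference \<open>h\<^sub>p - h\<^sub>q\<close> with \<open>q < p\<close> is an \<open>\<epsilon>\<close>-almost period.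
  The translates by the \<open>h\<^sub>p\<close> have pairwise distance at least \<open>\<epsilon>\<close>, so no subsequence converges.
\<close>

section \<open>The pseudometric on discrete multiple sets\<close>

lemma ms_dist_le_of_bij:
  fixes a b :: "nat \<Rightarrow> real ^ 'k"
  assumes "bij \<sigma>" "\<And>n. norm (a n - b (\<sigma> n)) \<le> e"
  shows "ms_dist a b \<le> ennreal e"
  unfolding ms_dist_def
  by (rule INF_lower2[of \<sigma>]) (auto intro!: SUP_least ennreal_leI assms)

lemma ms_dist_less_obtain_bij:
  fixes a b :: "nat \<Rightarrow> real ^ 'k"
  assumes "ms_dist a b < ennreal e"
  obtains \<sigma> where "bij \<sigma>" "\<And>n. norm (a n - b (\<sigma> n)) < e"
proof -
  from assms obtain \<sigma> where \<sigma>: "bij \<sigma>"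
    "(SUP n. ennreal (norm (a n - b (\<sigma> n)))) < ennreal e"
    by (auto simp: ms_dist_def INF_less_iff)
  have "ennreal (norm (a n - b (\<sigma> n))) < ennreal e" for n
    using \<sigma>(2) by (meson SUP_upper UNIV_I le_less_trans)
  then have "norm (a n - b (\<sigma> n)) < e" for n
    by (simp add: ennreal_less_iff)
  then show thesis
    using \<sigma>(1) that by blast
qed

lemma ms_dist_commute:
  fixes a b :: "nat \<Rightarrow> real ^ 'k"
  shows "ms_dist a b = ms_dist b a"
proof -
  have "ms_dist b a \<le> ms_dist a b" for a b :: "nat \<Rightarrow> real ^ 'k"
    unfolding ms_dist_def
  proof (rule INF_mono)
    fix \<sigma> :: "nat \<Rightarrow> nat" assume "\<sigma> \<in> {\<sigma>. bij \<sigma>}"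
    then have \<sigma>: "bij \<sigma>" by simp
    have "(SUP n. ennreal (norm (b n - a (inv \<sigma> n)))) \<le> (SUP n. ennreal (norm (a n - b (\<sigma> n))))"
    proof (rule SUP_least)
      fix n
      have "\<sigma> (inv \<sigma> n) = n"
        using \<sigma> by (simp add: bij_is_surj surj_f_inv_f)
      then show "ennreal (norm (b n - a (inv \<sigma> n))) \<le> (SUP n. ennreal (norm (a n - b (\<sigma> n))))"
        by (auto intro: SUP_upper2[where i = "inv \<sigma> n"] simp: norm_minus_commute)
    qed
    then show "\<exists>\<sigma>'\<in>{\<sigma>. bij \<sigma>}. (SUP n. ennreal (norm (b n - a (\<sigma>' n))))
        \<le> (SUP n. ennreal (norm (a n - b (\<sigma> n))))"
      using \<sigma> bij_imp_bij_inv by blast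
  qed
  then show ?thesis
    by (intro antisym)
qed

lemma ms_dist_triangle:
  fixes a b c :: "nat \<Rightarrow> real ^ 'k"
  shows "ms_dist a c \<le> ms_dist a b + ms_dist b c"
proof (rule ennreal_le_epsilon)
  fix e :: real
  assume fin: "ms_dist a b + ms_dist b c < top" and e: "0 < e"
  then obtain x y where x: "ms_dist a b = ennreal x" "0 \<le> x"
    and y: "ms_dist b c = ennreal y" "0 \<le> y"
    by (cases "ms_dist a b"; cases "ms_dist b c") auto
  obtain \<sigma> where \<sigma>: "bij \<sigma>" "\<And>n. norm (a n - b (\<sigma> n)) < x + e / 2"
    using ms_dist_less_obtain_bij[of a b "x + e / 2"] x e by (auto simp: ennreal_less_iff)
  obtain \<rho> where \<rho>: "bij \<rho>" "\<And>n. norm (b n - c (\<rho> n)) < y + e / 2"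
    using ms_dist_less_obtain_bij[of b c "y + e / 2"] y e by (auto simp: ennreal_less_iff)
  have "norm (a n - c ((\<rho> \<circ> \<sigma>) n)) \<le> x + y + e" for n
    using norm_triangle_ineq[of "a n - b (\<sigma> n)" "b (\<sigma> n) - c (\<rho> (\<sigma> n))"]
      \<sigma>(2)[of n] \<rho>(2)[of "\<sigma> n"] by simp
  then have "ms_dist a c \<le> ennreal (x + y + e)"
    using \<sigma>(1) \<rho>(1) by (intro ms_dist_le_of_bij[of "\<rho> \<circ> \<sigma>"] bij_comp)
  then show "ms_dist a c \<le> ms_dist a b + ms_dist b c + ennreal e"
    using x y e by (simp add: ennreal_plus)
qed

lemma ms_dist_triangle_less:
  fixes a b c :: "nat \<Rightarrow> real ^ 'k"
  assumes "ms_dist a b < ennreal d" "ms_dist b c < ennreal e"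
  shows "ms_dist a c < ennreal (d + e)"
proof -
  have pos: "0 < d" "0 < e"
    using assms by (metis ennreal_neg linorder_not_less not_less_zero)+
  have "ms_dist a c \<le> ms_dist a b + ms_dist b c"
    by (rule ms_dist_triangle)
  also have "\<dots> < ennreal d + ennreal e"
    using assms by (rule add_strict_mono)
  also have "\<dots> = ennreal (d + e)"
    using pos by (simp add: ennreal_plus)
  finally show ?thesis .
qed

lemma ms_translate_translate: "ms_translate (ms_translate a h) g = ms_translate a (h + g)"
  by (simp add: ms_translate_def add.assoc)

lemma ms_dist_translate_both:
  fixes a b :: "nat \<Rightarrow> real ^ 'k"
  shows "ms_dist (ms_translate a h) (ms_translate b h) = ms_dist a b"
  by (simp add: ms_dist_def ms_translate_def)

lemma ms_dist_translates:
  fixes a :: "nat \<Rightarrow> real ^ 'k"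
  shows "ms_dist (ms_translate a g) (ms_translate a h) = ms_dist a (ms_translate a (h - g))"
  using ms_dist_translate_both[of a g "ms_translate a (h - g)"]
  by (simp add: ms_translate_translate)

lemma ms_dist_translate_le:
  fixes a :: "nat \<Rightarrow> real ^ 'k"
  shows "ms_dist a (ms_translate a h) \<le> ennreal (norm h)"
  by (rule ms_dist_le_of_bij[of id]) (auto simp: ms_translate_def)

lemma discrete_multiple_set_translate:
  fixes a :: "nat \<Rightarrow> real ^ 'k"
  assumes "discrete_multiple_set a"
  shows "discrete_multiple_set (ms_translate a h)"
  unfolding discrete_multiple_set_iff_bounded
proof (intro allI impI)
  fix B :: "(real ^ 'k) set" assume "bounded B"
  then have "bounded ((\<lambda>x. x - h) ` B)"
    using bounded_translation_minus by blast
  then have "finite {n. a n \<in> (\<lambda>x. x - h) ` B}"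
    using assms discrete_multiple_set_iff_bounded by blast
  moreover have "{n. ms_translate a h n \<in> B} \<subseteq> {n. a n \<in> (\<lambda>x. x - h) ` B}"
    by (force simp: ms_translate_def)
  ultimately show "finite {n. ms_translate a h n \<in> B}"
    by (rule rev_finite_subset)
qed

text \<open>
  If \<open>b n\<close> lies in a bounded set, then \<open>a n\<close> lies in its closed \<open>C\<close>-neighbourhood, which is
  bounded as well and so contains only finitely many of the \<open>a n\<close>.
\<close>

lemma discrete_multiple_set_bounded_perturbation:
  fixes a b :: "nat \<Rightarrow> real ^ 'k"
  assumes a: "discrete_multiple_set a" and ab: "\<And>n. norm (a n - b n) \<le> C"
  shows "discrete_multiple_set b"
  unfolding discrete_multiple_set_iff_bounded
proof (intro allI impI)
  fix B :: "(real ^ 'k) set" assume "bounded B"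
  then obtain R where R: "\<And>x. x \<in> B \<Longrightarrow> norm x \<le> R"
    by (auto simp: bounded_iff)
  have "finite {n. a n \<in> cball 0 (R + C)}"
    using a discrete_multiple_set_iff_bounded bounded_cball by blast
  moreover have "{n. b n \<in> B} \<subseteq> {n. a n \<in> cball 0 (R + C)}"
  proof
    fix n assume "n \<in> {n. b n \<in> B}"
    then show "n \<in> {n. a n \<in> cball 0 (R + C)}"
      using R[of "b n"] ab[of n] norm_triangle_sub[of "a n" "b n"] by simp
  qed
  ultimately show "finite {n. b n \<in> B}"
    by (rule rev_finite_subset)
qed

section \<open>Completeness\<close>

text \<open>
  Matchings of consecutive sets are composed to \<open>\<Sigma> p\<close>, which follows each point of the first
  set into the set number \<open>p\<close>. In this numbering every point moves by less than \<open>2\<^sup>-\<^sup>p\<close>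
  at step \<open>p\<close>, so all points converge at a uniform rate; the limits stay within bounded
  distance of the first set, hence form a discrete multiple set.
\<close>

lemma fast_Cauchy_ms_converges:
  fixes b :: "nat \<Rightarrow> nat \<Rightarrow> real ^ 'k"
  assumes discrete: "discrete_multiple_set (b 0)"
    and close: "\<And>p. ms_dist (b p) (b (Suc p)) < ennreal ((1/2) ^ p)"
  shows "\<exists>D. discrete_multiple_set D \<and> (\<lambda>p. ms_dist (b p) D) \<longlonglongrightarrow> 0"
proof -
  have "\<exists>\<sigma>. bij \<sigma> \<and> (\<forall>n. norm (b p n - b (Suc p) (\<sigma> n)) < (1/2) ^ p)" for p
    using ms_dist_less_obtain_bij[OF close[of p]] by blast
  then obtain \<sigma> where bij: "\<And>p. bij (\<sigma> p)"
    and \<sigma>: "\<And>p n. norm (b p n - b (Suc p) (\<sigma> p n)) < (1/2) ^ p"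
    by metis
  define \<Sigma> where "\<Sigma> = rec_nat id (\<lambda>p f. \<sigma> p \<circ> f)"
  have \<Sigma>_simps: "\<Sigma> 0 = id" "\<And>p. \<Sigma> (Suc p) = \<sigma> p \<circ> \<Sigma> p"
    by (simp_all add: \<Sigma>_def)
  have bij_\<Sigma>: "bij (\<Sigma> p)" for p
    by (induction p) (simp_all only: \<Sigma>_simps bij_id bij_comp bij)
  define c where "c p = b p \<circ> \<Sigma> p" for p
  have step: "norm (c p n - c (Suc p) n) < (1/2) ^ p" for p n
    using \<sigma>[of p "\<Sigma> p n"] by (simp add: c_def \<Sigma>_simps)
  have geometric: "norm (c p n - c (p + m) n) \<le> 2 * (1/2) ^ p - 2 * (1/2) ^ (p + m)" for p m n
  proof (induction m)
    case (Suc m)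
    show ?case
      using Suc step[of "p + m" n]
        norm_triangle_ineq[of "c p n - c (p + m) n" "c (p + m) n - c (Suc (p + m)) n"]
      by simp
  qed simp
  have tail: "norm (c p n - c q n) \<le> 2 * (1/2) ^ p" if pq: "p \<le> q" for p q n
  proof -
    obtain m where m: "q = p + m"
      using pq le_Suc_ex by blast
    have "(0::real) \<le> 2 * (1/2) ^ (p + m)"
      by simp
    then show ?thesis
      using geometric[of p n m] unfolding m by linarith
  qed
  have small: "(\<lambda>p. 2 * (1/2) ^ p :: real) \<longlonglongrightarrow> 0"
    by (rule tendsto_mult_right_zero) (simp add: LIMSEQ_power_zero)
  have "\<exists>x. (\<lambda>p. c p n) \<longlonglongrightarrow> x" for n
  proof -
    have "Cauchy (\<lambda>p. c p n)"
    proof (rule metric_CauchyI)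
      fix e :: real assume "0 < e"
      then obtain N where N: "2 * (1/2) ^ N < e / 2"
        using order_tendstoD(2)[OF small, of "e / 2"] by (auto simp: eventually_sequentially)
      have "dist (c p n) (c q n) < e" if "N \<le> p" "N \<le> q" for p q
        using tail[OF that(1), of n] tail[OF that(2), of n] N
          dist_triangle3[of "c p n" "c q n" "c N n"] by (simp add: dist_norm)
      then show "\<exists>M. \<forall>p\<ge>M. \<forall>q\<ge>M. dist (c p n) (c q n) < e"
        by blast
    qed
    then show ?thesis
      using Cauchy_convergent convergent_def by blast
  qed
  then obtain D where D: "\<And>n. (\<lambda>p. c p n) \<longlonglongrightarrow> D n"
    by metis
  have unif: "norm (c p n - D n) \<le> 2 * (1/2) ^ p" for p n
  proof (rule tendsto_upperbound)
    show "(\<lambda>q. norm (c p n - c q n)) \<longlonglongrightarrow> norm (c p n - D n)"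
      by (intro tendsto_intros D)
    show "\<forall>\<^sub>F q in sequentially. norm (c p n - c q n) \<le> 2 * (1/2) ^ p"
      using tail eventually_sequentially by blast
  qed simp
  have "discrete_multiple_set D"
    using discrete_multiple_set_bounded_perturbation[OF discrete, of D 2] unif[of 0]
    by (simp add: c_def \<Sigma>_simps)
  moreover have "(\<lambda>p. ms_dist (b p) D) \<longlonglongrightarrow> 0"
  proof (rule tendsto_sandwich[OF _ _ tendsto_const])
    have "ms_dist (b p) D \<le> ennreal (2 * (1/2) ^ p)" for p
      using ms_dist_permute[OF bij_\<Sigma>[of p] bij_id, of "b p" D]
        ms_dist_le_of_bij[OF bij_id, of "c p" D] unif[of p] by (simp add: c_def)
    then show "\<forall>\<^sub>F p in sequentially. ms_dist (b p) D \<le> ennreal (2 * (1/2) ^ p)"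
      by simp
    show "(\<lambda>p. ennreal (2 * (1/2) ^ p)) \<longlonglongrightarrow> 0"
      using tendsto_ennrealI[OF small] by simp
  qed auto
  ultimately show ?thesis
    by blast
qed

section \<open>Precompactness of the translates\<close>

text \<open>
  Relative density writes \<open>h p = \<tau> p + \<rho> p\<close> with an almost period \<open>\<tau> p\<close> and a bounded
  remainder \<open>\<rho> p\<close>. Replacing \<open>h p\<close> by \<open>\<rho> p\<close> moves the translate by less than \<open>\<epsilon>/3\<close>, and
  the remainders are within \<open>\<epsilon>/3\<close> of each other along a subsequence.
\<close>

lemma almost_periodic_subseq_close:
  fixes a :: "nat \<Rightarrow> real ^ 'k"
  assumes ap: "almost_periodic a" and \<epsilon>: "0 < \<epsilon>"
  shows "\<exists>r :: nat \<Rightarrow> nat. strict_mono r \<and>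
    (\<forall>p q. ms_dist (ms_translate a (h (r p))) (ms_translate a (h (r q))) < ennreal \<epsilon>)"
proof -
  define \<delta> where "\<delta> = \<epsilon> / 3"
  have \<delta>: "0 < \<delta>" "\<delta> + \<delta> + \<delta> = \<epsilon>"
    using \<epsilon> by (simp_all add: \<delta>_def)
  obtain L where L: "\<And>x. ball x L \<inter> {\<tau>. almost_period a \<delta> \<tau>} \<noteq> {}"
    using ap \<delta>(1) unfolding almost_periodic_def relatively_dense_def by blast
  have "\<exists>\<tau>. dist (h p) \<tau> < L \<and> almost_period a \<delta> \<tau>" for p
    using L[of "h p"] by auto
  then obtain \<tau> where \<tau>: "\<And>p. dist (h p) (\<tau> p) < L" "\<And>p. almost_period a \<delta> (\<tau> p)"
    by metis
  define \<rho> where "\<rho> p = h p - \<tau> p" for p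
  have "bounded (range \<rho>)"
    using \<tau>(1) by (auto simp: bounded_iff \<rho>_def dist_norm intro!: exI[of _ L] less_imp_le)
  then obtain l s where s: "strict_mono (s :: nat \<Rightarrow> nat)" "(\<rho> \<circ> s) \<longlonglongrightarrow> l"
    using bounded_imp_convergent_subsequence by blast
  then obtain N where N: "\<And>p q. N \<le> p \<Longrightarrow> N \<le> q \<Longrightarrow> dist (\<rho> (s p)) (\<rho> (s q)) < \<delta>"
    using metric_CauchyD[OF LIMSEQ_imp_Cauchy[OF s(2)] \<delta>(1)] by auto
  have to_remainder: "ms_dist (ms_translate a (\<rho> p)) (ms_translate a (h p)) < ennreal \<delta>" for p
    using \<tau>(2)[of p] by (simp add: ms_dist_translates \<rho>_def almost_period_def)
  have remainders: "ms_dist (ms_translate a (\<rho> (s p))) (ms_translate a (\<rho> (s q))) < ennreal \<delta>"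
    if "N \<le> p" "N \<le> q" for p q
  proof -
    have "ms_dist (ms_translate a (\<rho> (s p))) (ms_translate a (\<rho> (s q)))
        \<le> ennreal (dist (\<rho> (s p)) (\<rho> (s q)))"
      using ms_dist_translate_le[of a "\<rho> (s q) - \<rho> (s p)"]
      by (simp add: ms_dist_translates dist_norm norm_minus_commute)
    also have "\<dots> < ennreal \<delta>"
      using N[OF that] by (simp add: ennreal_less_iff)
    finally show ?thesis .
  qed
  define r where "r p = s (N + p)" for p
  have "strict_mono r"
    using s(1) by (simp add: strict_mono_def r_def)
  moreover have "ms_dist (ms_translate a (h (r p))) (ms_translate a (h (r q))) < ennreal \<epsilon>" for p q
  proof -
    have "ms_dist (ms_translate a (h (r p))) (ms_translate a (\<rho> (r p))) < ennreal \<delta>"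
      using to_remainder by (simp add: ms_dist_commute)
    moreover have "ms_dist (ms_translate a (\<rho> (r p))) (ms_translate a (\<rho> (r q))) < ennreal \<delta>"
      using remainders by (simp add: r_def)
    ultimately have "ms_dist (ms_translate a (h (r p))) (ms_translate a (\<rho> (r q))) < ennreal (\<delta> + \<delta>)"
      by (rule ms_dist_triangle_less)
    then show ?thesis
      using ms_dist_triangle_less[OF _ to_remainder] \<delta>(2) by metis
  qed
  ultimately show ?thesis
    by blast
qed

lemma fast_Cauchy_translates:
  fixes a :: "nat \<Rightarrow> real ^ 'k"
  assumes "almost_periodic a"
  shows "\<exists>r :: nat \<Rightarrow> nat. strict_mono r \<and>
    (\<forall>p. ms_dist (ms_translate a (h (r p))) (ms_translate a (h (r (Suc p)))) < ennreal ((1/2) ^ p))"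
proof -
  define P where "P k s \<longleftrightarrow> (\<forall>p q. ms_dist (ms_translate a (h (s p))) (ms_translate a (h (s q)))
      < ennreal ((1/2) ^ k))" for k and s :: "nat \<Rightarrow> nat"
  have P_D: "ms_dist (ms_translate a (h (s p))) (ms_translate a (h (s q))) < ennreal ((1/2) ^ k)"
    if "P k s" for k s p q
    using that by (simp add: P_def)
  interpret subseqs P
  proof
    fix k and s :: "nat \<Rightarrow> nat"
    show "\<exists>r'. strict_mono r' \<and> P k (s \<circ> r')"
      using almost_periodic_subseq_close[OF assms, of "(1/2) ^ k" "h \<circ> s"] by (simp add: P_def)
  qed
  have P_diag: "P k (diagseq \<circ> (+) (Suc k))" for k
    by (rule diagseq_holds) (simp add: P_def)
  \<comment> \<open>Only the entries of the diagonal sequence from \<open>Suc k\<close> on are \<open>2\<^sup>-\<^sup>k\<close>-close, hence the shift.\<close>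
  define r where "r = diagseq \<circ> Suc"
  have "strict_mono r"
    unfolding r_def by (intro strict_mono_o subseq_diagseq) (simp add: strict_mono_def)
  moreover have "ms_dist (ms_translate a (h (r p))) (ms_translate a (h (r (Suc p))))
      < ennreal ((1/2) ^ p)" for p
    using P_D[OF P_diag[of p], of 0 1] by (simp add: r_def)
  ultimately show ?thesis
    by blast
qed

section \<open>Separated translates\<close>

text \<open>
  If the set \<open>E\<close> misses a ball of radius larger than every \<open>norm (h q)\<close> chosen so far, the
  center of this ball is the next vector: its differences to the earlier ones stay in the ball.
\<close>

lemma not_relatively_dense_separated_sequence:
  fixes E :: "(real ^ 'k) set"
  assumes "\<not> relatively_dense E"
  shows "\<exists>h :: nat \<Rightarrow> real ^ 'k. \<forall>p. \<forall>q<p. h p - h q \<notin> E"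
proof -
  have "\<exists>x. \<forall>q<p. x - f q \<notin> E" for p :: nat and f :: "nat \<Rightarrow> real ^ 'k"
  proof -
    define L where "L = (\<Sum>q<p. norm (f q)) + 1"
    obtain x where x: "ball x L \<inter> E = {}"
      using assms unfolding relatively_dense_def by blast
    have "x - f q \<in> ball x L" if "q < p" for q
    proof -
      have "norm (f q) \<le> (\<Sum>q<p. norm (f q))"
        using that by (intro member_le_sum) auto
      then show ?thesis
        by (simp add: L_def dist_norm)
    qed
    then show ?thesis
      using x by blast
  qed
  then show ?thesis
    by (intro dependent_wf_choice[OF wf_less_than, of "\<lambda>h p x. \<forall>q<p. x - h q \<notin> E"]) auto
qed

section \<open>Bochner's criterion\<close>

theorem theorem2:
  fixes a :: "nat \<Rightarrow> real ^ 'k"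
  assumes "discrete_multiple_set a"
  shows "almost_periodic a \<longleftrightarrow>
    (\<forall>h :: nat \<Rightarrow> real ^ 'k. \<exists>r :: nat \<Rightarrow> nat. strict_mono r \<and>
      (\<exists>D'. discrete_multiple_set D' \<and>
        (\<lambda>p. ms_dist (ms_translate a ((h \<circ> r) p)) D') \<longlonglongrightarrow> 0))"
proof (intro iffI allI)
  fix h :: "nat \<Rightarrow> real ^ 'k"
  assume "almost_periodic a"
  then obtain r :: "nat \<Rightarrow> nat" where r: "strict_mono r"
    "\<And>p. ms_dist (ms_translate a (h (r p))) (ms_translate a (h (r (Suc p)))) < ennreal ((1/2) ^ p)"
    using fast_Cauchy_translates by blast
  have "\<exists>D'. discrete_multiple_set D' \<and> (\<lambda>p. ms_dist (ms_translate a (h (r p))) D') \<longlonglongrightarrow> 0"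
    using discrete_multiple_set_translate[OF assms] r(2) by (intro fast_Cauchy_ms_converges)
  then show "\<exists>r :: nat \<Rightarrow> nat. strict_mono r \<and>
      (\<exists>D'. discrete_multiple_set D' \<and>
        (\<lambda>p. ms_dist (ms_translate a ((h \<circ> r) p)) D') \<longlonglongrightarrow> 0)"
    using r(1) by auto
next
  assume conv: "\<forall>h :: nat \<Rightarrow> real ^ 'k. \<exists>r :: nat \<Rightarrow> nat. strict_mono r \<and>
      (\<exists>D'. discrete_multiple_set D' \<and>
        (\<lambda>p. ms_dist (ms_translate a ((h \<circ> r) p)) D') \<longlonglongrightarrow> 0)"
  show "almost_periodic a"
    unfolding almost_periodic_def
  proof (intro allI impI, rule ccontr)
    fix \<epsilon> :: real
    assume \<epsilon>: "0 < \<epsilon>" and "\<not> relatively_dense {\<tau>. almost_period a \<epsilon> \<tau>}"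
    then obtain h :: "nat \<Rightarrow> real ^ 'k"
      where h: "\<And>p q. q < p \<Longrightarrow> \<not> almost_period a \<epsilon> (h p - h q)"
      using not_relatively_dense_separated_sequence by blast
    obtain r D' where r: "strict_mono (r :: nat \<Rightarrow> nat)"
      and D': "(\<lambda>p. ms_dist (ms_translate a ((h \<circ> r) p)) D') \<longlonglongrightarrow> 0"
      using conv by blast
    have "\<forall>\<^sub>F p in sequentially. ms_dist (ms_translate a ((h \<circ> r) p)) D' < ennreal (\<epsilon> / 2)"
      using \<epsilon> by (intro order_tendstoD(2)[OF D']) simp
    then obtain N where N: "\<And>p. N \<le> p \<Longrightarrow> ms_dist (ms_translate a (h (r p))) D' < ennreal (\<epsilon> / 2)"
      by (auto simp: eventually_sequentially)
    have "ms_dist (ms_translate a (h (r N))) (ms_translate a (h (r (Suc N)))) < ennreal (\<epsilon> / 2 + \<epsilon> / 2)"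
      using N[of N] N[of "Suc N"] ms_dist_commute[of D']
      by (intro ms_dist_triangle_less[where b = D']) auto
    then have "almost_period a \<epsilon> (h (r (Suc N)) - h (r N))"
      by (simp add: almost_period_def ms_dist_translates)
    then show False
      using h r by (simp add: strict_mono_def)
  qed
qed

end
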